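(* Let $0<q<1$, let $t\in\mathbb{C}$ with $0<|t|<1$, and let $C_n[z]=C_n\bigl(\tfrac12(z+z^{-1});t\mid q\bigr)$ be the continuous $q$-ultraspherical polynomials. Then for all $n\ge0$ the following structure relation holds: $$\frac{(1-tz^2)(z^{-2}-q^{\frac12})}{z-z^{-1}}\,C_n[q^{\frac12}z]-\frac{(1-tz^{-2})(z^2-q^{\frac12})}{z-z^{-1}}\,C_n[q^{-\frac12}z]=-\frac{(1-tq^{n+\frac12})(1-q^{n+1})}{q^{\frac12n}(1-tq^n)}\,C_{n+1}[z]+\frac{(1-tq^{n-\frac12})(1-t^2q^{n-1})}{q^{\frac12n-\frac12}(1-tq^n)}\,C_{n-1}[z].$$
   Context: $q$-Pochhammer symbols: $(u;q)_n=\prod_{j=0}^{n-1}(1-uq^j)$, $(u_1,\dots,u_r;q)_n=\prod_i(u_i;q)_n$. For polynomials in $x=\tfrac12(z+z^{-1})$ write $f[z]=f(\tfrac12(z+z^{-1}))$. The Askey-Wilson polynomials are $$p_n\bigl(\tfrac12(z+z^{-1});a,b,c,d\mid q\bigr)=\frac{(ab,ac,ad;q)_n}{a^n}\sum_{k=0}^n\frac{(q^{-n},q^{n-1}abcd,az,az^{-1};q)_k}{(ab,ac,ad,q;q)_k}\,q^k.$$ The continuous $q$-ultraspherical polynomials are $$C_n[z]=\frac{(t;q^{\frac12})_n}{(q^{\frac12}t;q)_n\,(q;q)_n}\,p_n\bigl(\tfrac12(z+z^{-1});t^{\frac12},-t^{\frac12},q^{\frac14},-q^{\frac14}\mid q^{\frac12}\bigr)$$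 (for any choice of the square root $t^{1/2}$). Convention: $C_{-1}:=0$. *)

theory Defs
  imports "HOL-Analysis.Analysis" "HOL-Computational_Algebra.Polynomial"
begin

definition qpoch :: "complex \<Rightarrow> complex \<Rightarrow> nat \<Rightarrow> complex" where
  "qpoch u q n = (\<Prod>j<n. 1 - u * q ^ j)"

definition qpochs :: "complex list \<Rightarrow> complex \<Rightarrow> nat \<Rightarrow> complex" where
  "qpochs us q n = (\<Prod>u\<leftarrow>us. qpoch u q n)"

text \<open>The bracket notation \<open>f[z]\<close> for a polynomial \<open>f\<close> in \<open>x = (z + 1/z) / 2\<close>.\<close>

definition bracket :: "complex poly \<Rightarrow> complex \<Rightarrow> complex" where
  "bracket f z = poly f ((z + inverse z) / 2)"

definition askey_wilson_rhs ::
    "complex \<Rightarrow> complex \<Rightarrow> complex \<Rightarrow> complex \<Rightarrow> complex \<Rightarrow> nat \<Rightarrow> complex \<Rightarrow> complex" where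
  "askey_wilson_rhs a b c d q n z =
     qpochs [a * b, a * c, a * d] q n / a ^ n *
     (\<Sum>k\<le>n. qpochs [q powi (- int n), q powi (int n - 1) * a * b * c * d, a * z, a * inverse z] q k
             / qpochs [a * b, a * c, a * d, q] q k * q ^ k)"

text \<open>The right-hand side is invariant under \<open>z \<mapsto> 1/z\<close> and is a polynomial in
  \<open>x = (z + 1/z) / 2\<close>; existence and uniqueness of this polynomial are proved in
  \<open>ex1_askey_wilson\<close>, so the description below always denotes.\<close>

definition askey_wilson ::
    "complex \<Rightarrow> complex \<Rightarrow> complex \<Rightarrow> complex \<Rightarrow> complex \<Rightarrow> nat \<Rightarrow> complex poly" where
  "askey_wilson a b c d q n =
     (THE p. \<forall>z. z \<noteq> 0 \<longrightarrow> bracket p z = askey_wilson_rhs a b c d q n z)"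

lemma ex_joukowski: "\<exists>z::complex. z \<noteq> 0 \<and> (z + inverse z) / 2 = x"
proof -
  define s where "s = csqrt (x\<^sup>2 - 1)"
  have s: "s\<^sup>2 = x\<^sup>2 - 1" by (simp add: s_def)
  have prod: "(x + s) * (x - s) = 1"
    using s by (simp add: algebra_simps power2_eq_square)
  then have "x + s \<noteq> 0" by auto
  moreover have "inverse (x + s) = x - s"
    using prod by (rule inverse_unique)
  ultimately show ?thesis by (intro exI[of _ "x + s"]) simp
qed

lemma ex1_askey_wilson:
  "\<exists>!p. \<forall>z. z \<noteq> 0 \<longrightarrow> bracket p z = askey_wilson_rhs a b c d q n z"
proof (rule ex_ex1I)
  define K where "K = qpochs [a * b, a * c, a * d] q n / a ^ n"
  define w where "w k = qpochs [q powi (- int n), q powi (int n - 1) * a * b * c * d] q k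
                          / qpochs [a * b, a * c, a * d, q] q k * q ^ k" for k
  define p where "p = smult K (\<Sum>k\<le>n. smult (w k)
                        (\<Prod>j<k. [:1 + a\<^sup>2 * (q ^ j)\<^sup>2, - 2 * a * q ^ j:]))"
  have "bracket p z = askey_wilson_rhs a b c d q n z" if "z \<noteq> 0" for z
  proof -
    have "1 + a\<^sup>2 * (q ^ j)\<^sup>2 + (z + inverse z) / 2 * (- 2 * a * q ^ j)
            = (1 - a * z * q ^ j) * (1 - a * inverse z * q ^ j)" for j
      using that by (simp add: field_simps power2_eq_square)
    then have "poly (\<Prod>j<k. [:1 + a\<^sup>2 * (q ^ j)\<^sup>2, - 2 * a * q ^ j:]) ((z + inverse z) / 2)
            = qpoch (a * z) q k * qpoch (a * inverse z) q k" for k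
      by (simp add: poly_prod qpoch_def prod.distrib del: mult_minus_left)
    then show ?thesis
      by (simp add: bracket_def p_def askey_wilson_rhs_def K_def w_def poly_sum qpochs_def
            mult_ac)
  qed
  then show "\<exists>p. \<forall>z. z \<noteq> 0 \<longrightarrow> bracket p z = askey_wilson_rhs a b c d q n z" by blast
next
  fix p p'
  assume "\<forall>z. z \<noteq> 0 \<longrightarrow> bracket p z = askey_wilson_rhs a b c d q n z"
    and "\<forall>z. z \<noteq> 0 \<longrightarrow> bracket p' z = askey_wilson_rhs a b c d q n z"
  then have "poly p x = poly p' x" for x
    using ex_joukowski[of x] unfolding bracket_def by metis
  then show "p = p'" by (simp add: poly_eq_poly_eq_iff[symmetric] fun_eq_iff)
qed

lemma bracket_askey_wilson:
  "z \<noteq> 0 \<Longrightarrow> bracket (askey_wilson a b c d q n) z = askey_wilson_rhs a b c d q n z"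
  using theI'[OF ex1_askey_wilson[of a b c d q n]] by (simp add: askey_wilson_def)

text \<open>The argument \<open>s\<close> is the chosen square root of \<open>t\<close>; the index ranges over the
  integers to accommodate the convention that the polynomial of index \<open>-1\<close> is \<open>0\<close>.\<close>

definition q_ultraspherical :: "complex \<Rightarrow> complex \<Rightarrow> real \<Rightarrow> int \<Rightarrow> complex poly" where
  "q_ultraspherical s t q m =
     (if m < 0 then 0
      else let n = nat m; p = complex_of_real (q powr (1/2)); r = complex_of_real (q powr (1/4)) in
        smult (qpoch t p n / (qpoch (p * t) (of_real q) n * qpoch (of_real q) (of_real q) n))
              (askey_wilson s (- s) r (- r) p n))"

end

(* Put p = q^(1/2) and b_k[z] = (sz, s/z; p)_k. The operator on the left-hand side is tridiagonal
   in this basis, with coefficients that do not depend on n: since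
   (1 - sz) (spz; p)_k = (sz; p)_(k+1) and (s/(pz); p)_k = (1 - s/(pz)) (s/z; p)_(k-1),
   it maps b_k to b_(k-1) times an explicit polynomial of degree 2 in z + 1/z. C_n is, up to a constant, the
   Askey-Wilson sum over k of w_(n,k) b_k, so the structure relation reduces, coefficient of b_k by
   coefficient, to one rational identity in p, t, p^n and p^k. *)

theory Submission
  imports Defs
begin

section \<open>q-Pochhammer symbols\<close>

lemma qpoch_0 [simp]: "qpoch u p 0 = 1"
  by (simp add: qpoch_def)

lemma qpoch_Suc: "qpoch u p (Suc n) = qpoch u p n * (1 - u * p ^ n)"
  by (simp add: qpoch_def)

lemma qpoch_Suc_shift: "qpoch u p (Suc n) = (1 - u) * qpoch (u * p) p n"
  unfolding qpoch_def prod.lessThan_Suc_shift by (simp add: mult_ac)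

text \<open>Factor by factor this is a difference of squares. It merges the pairs of opposite
  parameters sr, -sr and t, -t, where r^2 = p, into symbols to the base p^2 = q.\<close>

lemma qpoch_mult_uminus: "qpoch u p n * qpoch (- u) p n = qpoch (u\<^sup>2) (p\<^sup>2) n"
  unfolding qpoch_def prod.distrib [symmetric]
  by (intro prod.cong refl) (simp add: algebra_simps power2_eq_square power_mult_distrib)

lemma qpoch_nonzero:
  assumes "norm u < 1" "norm p < 1"
  shows "qpoch u p n \<noteq> 0"
proof -
  have "norm (u * p ^ j) < 1" for j
  proof -
    have "norm (u * p ^ j) \<le> norm u * 1"
      unfolding norm_mult norm_power using assms by (intro mult_left_mono power_le_one) auto
    then show ?thesis using assms by simp
  qed
  then have "u * p ^ j \<noteq> 1" for j
    by (metis norm_one less_irrefl)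
  then show ?thesis by (simp add: qpoch_def)
qed

section \<open>Two rational identities\<close>

text \<open>This is what remains of \<open>wgt_recurrence\<close> for k = j + 1 once the common
  factor of all five terms is removed, with R = p^j. The summands on the left come from
  \<open>raise\<close>, \<open>lower\<close> and \<open>diag\<close> in the order k + 1, k, k - 1 of
  the weights they stem from: first \<open>lower\<close>, then \<open>diag\<close>, then
  \<open>raise\<close>.\<close>

lemma coefficient_identity:
  fixes p t N R :: complex
  assumes "p \<noteq> 0" "N \<noteq> 0" "R \<noteq> 0" "1 - t * N\<^sup>2 \<noteq> 0"
  shows "(1 - R / N) * (1 - t * N * R) * (1 - p * R / N) * (1 - t * N * p * R) * (1 - t * p ^ 3 * R\<^sup>2) / (p\<^sup>2 * R\<^sup>2)
      + (1 - R / N) * (1 - t * N * R) * ((p\<^sup>2 * R - (1 + p) - t * p * R + t * p ^ 4 * R ^ 3 + t\<^sup>2 * p ^ 4 * R ^ 4 * (1 + p) - t\<^sup>2 * p ^ 3 * R ^ 3) / (p\<^sup>2 * R\<^sup>2))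
      + (1 - p * R) * (1 + t * R) * (1 - t * p * R\<^sup>2)\<^sup>2 / (p * R\<^sup>2)
     = (- ((1 - t * p * N\<^sup>2) * (1 + t * N) * (1 - 1 / (p * N)) * (1 - t * N * R) * (1 - t * N * p * R)) / N
        - t * p * (1 - t * N\<^sup>2 / p) * (1 + N) * (1 - t * N / p) * (1 - R / N) * (1 - p * R / N)) / (1 - t * N\<^sup>2)"
    (is "?L = ?R")
  using assms by (simp add: divide_simps) algebra

text \<open>With R = p^j this is the action of the operator on b_(j+1), divided by b_j. The
  left-hand side changes sign under z -> 1/z and has degree 3 in z, so z - 1/z divides it; the
  quotient has degree 2 in z + 1/z and is expanded in the successive quotients 1, b_(j+1)/b_j,
  b_(j+2)/b_j.\<close>

lemma basis_identity:
  fixes p s t z R :: complex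
  assumes "p \<noteq> 0" "s \<noteq> 0" "R \<noteq> 0" "z \<noteq> 0" and t: "s\<^sup>2 = t"
  shows "(1 + s * z) * (1 - s / (p * z)) * (1 / z\<^sup>2 - p) * (1 - s * z * R) * (1 - s * z * p * R)
      - (1 + s / z) * (1 - s * z / p) * (z\<^sup>2 - p) * (1 - s * R / z) * (1 - s * p * R / z)
     = (z - 1 / z) * ((1 - p * R) * (1 + t * R) * (1 - t * p * R\<^sup>2)\<^sup>2 / (s * p * R\<^sup>2)
      + (p\<^sup>2 * R - (1 + p) - t * p * R + t * p ^ 4 * R ^ 3 + t\<^sup>2 * p ^ 4 * R ^ 4 * (1 + p) - t\<^sup>2 * p ^ 3 * R ^ 3) / (s * p\<^sup>2 * R\<^sup>2)
          * ((1 - s * z * R) * (1 - s * R / z))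
      + (1 - t * p ^ 3 * R\<^sup>2) / (s * p\<^sup>2 * R\<^sup>2)
          * ((1 - s * z * R) * (1 - s * R / z) * (1 - s * z * p * R) * (1 - s * p * R / z)))"
  unfolding t [symmetric] using assms(1-4) 
  by (simp add: divide_simps) algebra

section \<open>The shift operator and its tridiagonal matrix\<close>

definition basis :: "complex \<Rightarrow> complex \<Rightarrow> complex \<Rightarrow> nat \<Rightarrow> complex" where
  "basis s p z k = qpoch (s * z) p k * qpoch (s / z) p k"

text \<open>It acts on functions of z rather than on polynomials in z + 1/z, because the value at pz
  is not determined by z + 1/z.\<close>

definition shift_op :: "complex \<Rightarrow> complex \<Rightarrow> (complex \<Rightarrow> complex) \<Rightarrow> complex \<Rightarrow> complex" where
  "shift_op t p f z = ((1 - t * z\<^sup>2) * (1 / z\<^sup>2 - p) * f (p * z)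
     - (1 - t / z\<^sup>2) * (z\<^sup>2 - p) * f (z / p)) / (z - 1 / z)"

text \<open>For the matrix entries of \<open>shift_op\<close> in this basis write \<open>Q = p ^ k\<close>. The quotients of
  \<open>basis k\<close> and \<open>basis (k + 1)\<close> by \<open>basis (k - 1)\<close> both vanish at \<open>z = p / (s * Q)\<close>, which gives \<open>lower\<close>;
  the second one also vanishes at \<open>z = 1 / (s * Q)\<close>, which gives \<open>diag\<close>; \<open>raise\<close> is read off from the
  leading coefficient.\<close>

definition lower :: "complex \<Rightarrow> complex \<Rightarrow> complex \<Rightarrow> nat \<Rightarrow> complex" where
  "lower s t p k = (let Q = p ^ k in
     (1 - Q) * (1 + t * Q / p) * (1 - t * Q\<^sup>2 / p)\<^sup>2 * p / (s * Q\<^sup>2))"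

definition diag :: "complex \<Rightarrow> complex \<Rightarrow> complex \<Rightarrow> nat \<Rightarrow> complex" where
  "diag s t p k = (let Q = p ^ k in
     (p * Q - (1 + p) - t * Q + t * p * Q ^ 3 + t\<^sup>2 * Q ^ 4 * (1 + p) - t\<^sup>2 * Q ^ 3) / (s * Q\<^sup>2))"

definition raise :: "complex \<Rightarrow> complex \<Rightarrow> complex \<Rightarrow> nat \<Rightarrow> complex" where
  "raise s t p k = (let Q = p ^ k in (1 - t * p * Q\<^sup>2) / (s * Q\<^sup>2))"

lemma shift_op_basis:
  assumes "p \<noteq> 0" "s \<noteq> 0" "z \<noteq> 0" "z - 1 / z \<noteq> 0" and t: "s\<^sup>2 = t"
  shows "shift_op t p (\<lambda>y. basis s p y k) z
    = lower s t p k * basis s p z (k - 1) + diag s t p k * basis s p z k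
      + raise s t p k * basis s p z (Suc k)"
proof (cases k)
  \<comment> \<open>The truncated index \<open>k - 1\<close> does no harm here: \<open>lower\<close>
    contains the factor 1 - p^k, which is 0.\<close>
  case 0
  have "z\<^sup>2 \<noteq> 1" using assms by (auto simp: field_simps power2_eq_square)
  then show ?thesis
    using assms(1-3) unfolding 0 t [symmetric]
    by (simp add: shift_op_def basis_def lower_def diag_def raise_def qpoch_Suc divide_simps) algebra
next
  case (Suc j)
  define R where "R = p ^ j"
  define X where "X = basis s p z j"
  have R: "R \<noteq> 0" using assms by (simp add: R_def)
  \<comment> \<open>The factor 1 - sz, which may vanish, is kept on the left instead of being
    divided out; \<open>tz\<close> supplies it from 1 - t z^2.\<close>
  have up: "(1 - s * z) * qpoch (s * (p * z)) p (Suc j)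
      = qpoch (s * z) p j * (1 - s * z * R) * (1 - s * z * p * R)"
    using qpoch_Suc_shift [of "s * z" p "Suc j", symmetric] by (simp add: qpoch_Suc R_def mult_ac)
  have dn: "qpoch (s / (p * z)) p (Suc j) = (1 - s / (p * z)) * qpoch (s / z) p j"
    using assms qpoch_Suc_shift [of "s / (p * z)" p j] by simp
  have up': "(1 - s / z) * qpoch (s / (z / p)) p (Suc j)
      = qpoch (s / z) p j * (1 - s * R / z) * (1 - s * p * R / z)"
    using qpoch_Suc_shift [of "s / z" p "Suc j", symmetric] by (simp add: qpoch_Suc R_def mult_ac)
  have dn': "qpoch (s * (z / p)) p (Suc j) = (1 - s * z / p) * qpoch (s * z) p j"
    using assms qpoch_Suc_shift [of "s * z / p" p j] by simp
  have tz: "1 - t * z\<^sup>2 = (1 + s * z) * (1 - s * z)" "1 - t / z\<^sup>2 = (1 + s / z) * (1 - s / z)"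
    unfolding t [symmetric] by (simp_all add: algebra_simps power2_eq_square)
  have 1: "(1 - t * z\<^sup>2) * (1 / z\<^sup>2 - p) * basis s p (p * z) k
      = X * ((1 + s * z) * (1 - s / (p * z)) * (1 / z\<^sup>2 - p) * (1 - s * z * R) * (1 - s * z * p * R))"
    unfolding tz basis_def Suc dn X_def using up by algebra
  have 2: "(1 - t / z\<^sup>2) * (z\<^sup>2 - p) * basis s p (z / p) k
      = X * ((1 + s / z) * (1 - s * z / p) * (z\<^sup>2 - p) * (1 - s * R / z) * (1 - s * p * R / z))"
    unfolding tz basis_def Suc dn' X_def using up' by algebra
  have b1: "basis s p z (Suc j) = X * ((1 - s * z * R) * (1 - s * R / z))"
    by (simp add: basis_def qpoch_Suc X_def R_def mult_ac)
  have b2: "basis s p z (Suc (Suc j))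
      = X * ((1 - s * z * R) * (1 - s * R / z) * (1 - s * z * p * R) * (1 - s * p * R / z))"
    by (simp add: basis_def qpoch_Suc X_def R_def mult_ac)
  have l: "lower s t p k = (1 - p * R) * (1 + t * R) * (1 - t * p * R\<^sup>2)\<^sup>2 / (s * p * R\<^sup>2)"
    using assms R by (simp add: Suc lower_def R_def [symmetric] field_simps power2_eq_square)
  have d: "diag s t p k = (p\<^sup>2 * R - (1 + p) - t * p * R + t * p ^ 4 * R ^ 3
      + t\<^sup>2 * p ^ 4 * R ^ 4 * (1 + p) - t\<^sup>2 * p ^ 3 * R ^ 3) / (s * p\<^sup>2 * R\<^sup>2)"
    using assms R by (simp add: Suc diag_def R_def [symmetric] field_simps eval_nat_numeral)
  have r: "raise s t p k = (1 - t * p ^ 3 * R\<^sup>2) / (s * p\<^sup>2 * R\<^sup>2)"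
    using assms R by (simp add: Suc raise_def R_def [symmetric] field_simps eval_nat_numeral)
  have "shift_op t p (\<lambda>y. basis s p y k) z * (z - 1 / z)
     = X * ((z - 1 / z) * (lower s t p k
         + diag s t p k * ((1 - s * z * R) * (1 - s * R / z))
         + raise s t p k * ((1 - s * z * R) * (1 - s * R / z) * (1 - s * z * p * R) * (1 - s * p * R / z))))"
    unfolding l d r basis_identity [OF assms(1-2) R assms(3) t, symmetric] shift_op_def 1 2
    by (simp only: times_divide_eq_left nonzero_mult_div_cancel_right [OF assms(4)] right_diff_distrib [of X])
  also have "\<dots> = (lower s t p k * basis s p z (k - 1) + diag s t p k * basis s p z k
      + raise s t p k * basis s p z (Suc k)) * (z - 1 / z)"
    by (simp add: Suc b1 b2 X_def [symmetric] algebra_simps)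
  finally show ?thesis using assms(4) by simp
qed

section \<open>The recurrence for the expansion coefficients\<close>

text \<open>The parameter \<open>N\<close> stands for \<open>p ^ n\<close>, so that the neighbours \<open>n + 1\<close> and \<open>n - 1\<close> become
  \<open>N * p\<close> and \<open>N / p\<close>, also for \<open>n = 0\<close>.\<close>

definition wgt :: "complex \<Rightarrow> complex \<Rightarrow> complex \<Rightarrow> nat \<Rightarrow> complex" where
  "wgt t p N k = qpoch (1 / N) p k * qpoch (t * N) p k * p ^ k
     / (qpoch (- t) p k * qpoch (t * p) (p\<^sup>2) k * qpoch p p k)"

text \<open>The left-hand side collects what b_(k+1), b_k and b_(k-1) contribute to the coefficient
  of b_k. All five terms are multiples of one product of Pochhammer symbols, which leaves
  \<open>coefficient_identity\<close>.\<close>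

lemma wgt_recurrence:
  assumes "p \<noteq> 0" "norm p < 1" "norm t < 1" "s \<noteq> 0" "s\<^sup>2 = t" "N \<noteq> 0" "1 - t * N\<^sup>2 \<noteq> 0"
  shows "wgt t p N (Suc k) * lower s t p (Suc k) + wgt t p N k * diag s t p k
      + (case k of 0 \<Rightarrow> 0 | Suc j \<Rightarrow> wgt t p N j * raise s t p j)
    = - ((1 - t * p * N\<^sup>2) * (1 - t\<^sup>2 * N\<^sup>2)) / (s * N * (1 - t * N\<^sup>2)) * wgt t p (N * p) k
      + s * p * (1 - t * N\<^sup>2 / p) * (1 - N\<^sup>2) / (N * (1 - t * N\<^sup>2)) * wgt t p (N / p) k"
proof -
  have norm_tp: "norm (t * p) < 1" "norm (p\<^sup>2) < 1"
    using mult_strict_mono' [of "norm t" 1 "norm p" 1] mult_strict_mono' [of "norm p" 1 "norm p" 1] assms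
    by (auto simp: norm_mult power2_eq_square)
  \<comment> \<open>This denominator does not involve N, so the weights for N, Np and N/p share
    it.\<close>
  define D where "D k = qpoch (- t) p k * qpoch (t * p) (p\<^sup>2) k * qpoch p p k" for k
  have D: "D k \<noteq> 0" for k
    using assms norm_tp by (simp add: D_def qpoch_nonzero)
  have D_Suc: "D (Suc k) = D k * ((1 + t * p ^ k) * (1 - t * p * (p ^ k)\<^sup>2) * (1 - p * p ^ k))" for k
    by (simp add: D_def qpoch_Suc mult_ac flip: power_mult)
  have fac: "1 + t * p ^ k \<noteq> 0" "1 - t * p * (p ^ k)\<^sup>2 \<noteq> 0" "1 - p * p ^ k \<noteq> 0" for k
    using D [of "Suc k"] unfolding D_Suc by auto
  define A where "A k = qpoch (1 / N) p k * qpoch (t * N) p k" for k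
  have A_Suc: "A (Suc k) = A k * ((1 - p ^ k / N) * (1 - t * N * p ^ k))" for k
    by (simp add: A_def qpoch_Suc mult_ac)
  have w: "wgt t p N k = A k * p ^ k / D k" for k
    by (simp add: wgt_def A_def D_def)
  \<comment> \<open>\<open>lower\<close> at k + 1 cancels all the factors by which
    \<open>D (Suc k)\<close> exceeds \<open>D k\<close>, and keeps one of its two factors 1 - t
    p^(2k+1).\<close>
  have low: "wgt t p N (Suc k) * lower s t p (Suc k)
      = A (Suc k) * (1 - t * p * (p ^ k)\<^sup>2) / (s * p ^ k * D k)" for k
  proof -
    define R where "R = p ^ k"
    have "R \<noteq> 0" using assms by (simp add: R_def)
    then show ?thesis
      using fac [of k] D [of k] assms(1,4) unfolding w D_Suc lower_def power_Suc R_def [symmetric] Let_def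
      by (simp add: divide_simps) (simp add: algebra_simps eval_nat_numeral)
  qed
  show ?thesis
  proof (cases k)
    case 0
    have [simp]: "wgt t p M 0 = 1" for M by (simp add: wgt_def)
    have A1: "A (Suc 0) = (1 - 1 / N) * (1 - t * N)" "D 0 = 1"
      by (simp_all add: A_def D_def qpoch_Suc)
    show ?thesis unfolding 0 low A1
      using assms(1,4-7) by (simp add: diag_def divide_simps) algebra
  next
    case (Suc j)
    define R where "R = p ^ j"
    \<comment> \<open>The common factor of the five terms: the numerator symbols of length j, with
      p^k and \<open>D k\<close> for k = j + 1.\<close>
    define X where "X = A j * p * R / (s * D (Suc j))"
    have R: "R \<noteq> 0" using assms by (simp add: R_def)
    have T1: "wgt t p N (Suc k) * lower s t p (Suc k) = X * ((1 - R / N) * (1 - t * N * R)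
        * (1 - p * R / N) * (1 - t * N * p * R) * (1 - t * p ^ 3 * R\<^sup>2) / (p\<^sup>2 * R\<^sup>2))"
      using D [of "Suc j"] assms R
      unfolding low Suc A_Suc X_def power_Suc R_def [symmetric]
      by (simp add: divide_simps) (simp add: algebra_simps eval_nat_numeral)
    have T2: "wgt t p N k * diag s t p k = X * ((1 - R / N) * (1 - t * N * R)
        * ((p\<^sup>2 * R - (1 + p) - t * p * R + t * p ^ 4 * R ^ 3 + t\<^sup>2 * p ^ 4 * R ^ 4 * (1 + p)
            - t\<^sup>2 * p ^ 3 * R ^ 3) / (p\<^sup>2 * R\<^sup>2)))"
      using D [of "Suc j"] assms R
      unfolding w diag_def Suc A_Suc X_def power_Suc R_def [symmetric] Let_def
      by (simp add: divide_simps) (simp add: algebra_simps eval_nat_numeral)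
    have T3: "wgt t p N j * raise s t p j
        = X * ((1 - p * R) * (1 + t * R) * (1 - t * p * R\<^sup>2)\<^sup>2 / (p * R\<^sup>2))"
      using D [of j] fac [of j] assms R
      unfolding w raise_def X_def D_Suc R_def [symmetric] Let_def
      by (simp add: divide_simps) (simp add: algebra_simps eval_nat_numeral)
    \<comment> \<open>Passing to Np shifts the two numerator parameters in opposite directions. The
      factor 1 - tN needed for the second is available from 1 - t^2 N^2 = (1 - tN)(1 + tN).\<close>
    have q4: "qpoch (1 / (N * p)) p (Suc j) = (1 - 1 / (p * N)) * qpoch (1 / N) p j"
        "(1 - t * N) * qpoch (t * (N * p)) p (Suc j)
          = qpoch (t * N) p j * (1 - t * N * R) * (1 - t * N * p * R)"
      using qpoch_Suc_shift [of "1 / (N * p)" p j] qpoch_Suc_shift [of "t * N" p "Suc j", symmetric] assms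
      by (simp_all add: qpoch_Suc R_def mult_ac)
    have T4: "(1 - t * N) * wgt t p (N * p) k
        = X * s * ((1 - 1 / (p * N)) * (1 - t * N * R) * (1 - t * N * p * R))"
    proof -
      have "(1 - t * N) * wgt t p (N * p) k = qpoch (1 / (N * p)) p (Suc j)
          * ((1 - t * N) * qpoch (t * (N * p)) p (Suc j)) * (p * R) / D (Suc j)"
        by (simp add: wgt_def D_def Suc R_def)
      then show ?thesis
        unfolding q4 X_def A_def using assms by (simp add: mult_ac)
    qed
    \<comment> \<open>Here 1 - 1/N must not be divided out, since it is 0 for N = 1, the case n = 0.
      It is taken from 1 - N^2 = -N (1 + N)(1 - 1/N).\<close>
    have q5: "qpoch (t * (N / p)) p (Suc j) = (1 - t * N / p) * qpoch (t * N) p j"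
        "(1 - 1 / N) * qpoch (1 / (N / p)) p (Suc j)
          = qpoch (1 / N) p j * (1 - R / N) * (1 - p * R / N)"
      using qpoch_Suc_shift [of "t * (N / p)" p j] qpoch_Suc_shift [of "1 / N" p "Suc j", symmetric] assms
      by (simp_all add: qpoch_Suc R_def mult_ac)
    have T5: "(1 - 1 / N) * wgt t p (N / p) k
        = X * s * ((1 - t * N / p) * (1 - R / N) * (1 - p * R / N))"
    proof -
      have "(1 - 1 / N) * wgt t p (N / p) k = ((1 - 1 / N) * qpoch (1 / (N / p)) p (Suc j))
          * qpoch (t * (N / p)) p (Suc j) * (p * R) / D (Suc j)"
        by (simp add: wgt_def D_def Suc R_def)
      then show ?thesis
        unfolding q5 X_def A_def using assms by (simp add: mult_ac)
    qed
    have "- ((1 - t * p * N\<^sup>2) * (1 - t\<^sup>2 * N\<^sup>2)) / (s * N * (1 - t * N\<^sup>2)) * wgt t p (N * p) k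
      = - ((1 - t * p * N\<^sup>2) * (1 + t * N)) / (s * N * (1 - t * N\<^sup>2)) * ((1 - t * N) * wgt t p (N * p) k)"
      by (simp add: power2_eq_square algebra_simps)
    also have "\<dots> = X * ((- ((1 - t * p * N\<^sup>2) * (1 + t * N) * (1 - 1 / (p * N)) * (1 - t * N * R)
        * (1 - t * N * p * R)) / N) / (1 - t * N\<^sup>2))"
      unfolding T4 using assms by simp
    finally have R1: "- ((1 - t * p * N\<^sup>2) * (1 - t\<^sup>2 * N\<^sup>2)) / (s * N * (1 - t * N\<^sup>2)) * wgt t p (N * p) k = \<dots>" .
    have "s * p * (1 - t * N\<^sup>2 / p) * (1 - N\<^sup>2) / (N * (1 - t * N\<^sup>2)) * wgt t p (N / p) k
      = - s * p * (1 - t * N\<^sup>2 / p) * (1 + N) / (1 - t * N\<^sup>2) * ((1 - 1 / N) * wgt t p (N / p) k)"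
    proof -
      have "(1 - N\<^sup>2) / (N * (1 - t * N\<^sup>2)) = - (1 + N) / (1 - t * N\<^sup>2) * (1 - 1 / N)"
        using assms(6,7) by (simp add: divide_simps) algebra
      then show ?thesis
        by (metis (no_types, opaque_lifting) mult.assoc mult_minus_left mult_minus_right times_divide_eq_right)
    qed
    also have "\<dots> = X * ((- t * p * (1 - t * N\<^sup>2 / p) * (1 + N) * (1 - t * N / p) * (1 - R / N)
        * (1 - p * R / N)) / (1 - t * N\<^sup>2))"
      unfolding T5 unfolding assms(5) [symmetric] by (simp add: power2_eq_square)
    finally have R2: "s * p * (1 - t * N\<^sup>2 / p) * (1 - N\<^sup>2) / (N * (1 - t * N\<^sup>2)) * wgt t p (N / p) k = \<dots>" .
    show ?thesis
      unfolding R1 R2 T1 T2 unfolding Suc nat.case T3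
        distrib_left [symmetric] coefficient_identity [OF assms(1,6) R assms(7)] 
      by (simp add: diff_divide_distrib)
  qed
qed

section \<open>From basis elements to the terminating sum\<close>

lemma shift_op_sum:
  "shift_op t p (\<lambda>y. \<Sum>k\<in>A. c k * f k y) z = (\<Sum>k\<in>A. c k * shift_op t p (f k) z)"
  unfolding shift_op_def sum_distrib_left sum_subtractf [symmetric] sum_divide_distrib
  by (intro sum.cong refl) (simp add: algebra_simps diff_divide_distrib)

text \<open>Collects the coefficients of each b_k by shifting indices. The hypothesis on
  \<open>l 0\<close> removes the term in which \<open>k - 1\<close> is truncated; the vanishing of w
  beyond n allows the longer range.\<close>

lemma sum_tridiagonal:
  fixes w l d r b :: "nat \<Rightarrow> 'a :: comm_ring_1"
  assumes "l 0 = 0" and w: "\<And>k. k > n \<Longrightarrow> w k = 0"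
  shows "(\<Sum>k\<le>n. w k * (l k * b (k - 1) + d k * b k + r k * b (Suc k)))
    = (\<Sum>k\<le>Suc n. (w (Suc k) * l (Suc k) + w k * d k
        + (case k of 0 \<Rightarrow> 0 | Suc j \<Rightarrow> w j * r j)) * b k)"
proof -
  have "(\<Sum>k\<le>Suc n. w (Suc k) * l (Suc k) * b k) = (\<Sum>k\<le>Suc (Suc n). w k * l k * b (k - 1))"
    unfolding sum.atMost_Suc_shift [of _ "Suc n"] by (simp add: assms(1))
  also have "\<dots> = (\<Sum>k\<le>n. w k * l k * b (k - 1))"
    by (simp add: w)
  moreover have "(\<Sum>k\<le>Suc n. (case k of 0 \<Rightarrow> 0 | Suc j \<Rightarrow> w j * r j) * b k)
      = (\<Sum>k\<le>n. w k * r k * b (Suc k))"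
    unfolding sum.atMost_Suc_shift by simp
  moreover have "(\<Sum>k\<le>Suc n. w k * d k * b k) = (\<Sum>k\<le>n. w k * d k * b k)"
    by (simp add: w)
  ultimately show ?thesis
    by (simp only: distrib_right distrib_left sum.distrib mult.assoc)
qed

text \<open>The factor with index n of (p^(-n); p)_k is 0.\<close>

lemma wgt_eq_0:
  assumes "p \<noteq> 0" "k > n"
  shows "wgt t p (p ^ n) k = 0"
proof -
  have "qpoch (1 / p ^ n) p k = 0"
    unfolding qpoch_def using assms by (auto intro!: bexI [of _ n] simp: prod_zero_iff)
  then show ?thesis by (simp add: wgt_def)
qed

text \<open>The terminating 4phi3 series to the base p inside C_n, without its prefactor.\<close>

definition basic_sum :: "complex \<Rightarrow> complex \<Rightarrow> complex \<Rightarrow> nat \<Rightarrow> complex \<Rightarrow> complex" where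
  "basic_sum s t p n z = (\<Sum>k\<le>n. wgt t p (p ^ n) k * basis s p z k)"

lemma basic_sum_extend:
  assumes "p \<noteq> 0" "m \<ge> n"
  shows "basic_sum s t p n z = (\<Sum>k\<le>m. wgt t p (p ^ n) k * basis s p z k)"
  unfolding basic_sum_def
  by (rule sum.mono_neutral_left) (use assms in \<open>auto simp: wgt_eq_0\<close>)

text \<open>The structure relation before normalization, obtained from \<open>wgt_recurrence\<close>
  at N = p^n.\<close>

lemma shift_op_basic_sum:
  assumes "p \<noteq> 0" "norm p < 1" "norm t < 1" "s \<noteq> 0" "s\<^sup>2 = t" "1 - t * (p ^ n)\<^sup>2 \<noteq> 0"
    and "z \<noteq> 0" "z - 1 / z \<noteq> 0"
  shows "shift_op t p (basic_sum s t p n) z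
    = - ((1 - t * p * (p ^ n)\<^sup>2) * (1 - t\<^sup>2 * (p ^ n)\<^sup>2)) / (s * p ^ n * (1 - t * (p ^ n)\<^sup>2))
        * basic_sum s t p (Suc n) z
      + s * p * (1 - t * (p ^ n)\<^sup>2 / p) * (1 - (p ^ n)\<^sup>2) / (p ^ n * (1 - t * (p ^ n)\<^sup>2))
        * basic_sum s t p (n - 1) z" (is "_ = ?A * _ + ?B * _")
proof -
  have N: "p ^ n \<noteq> 0" using assms by simp
  \<comment> \<open>For n = 0 the index \<open>n - 1\<close> is 0 and N/p is not p^(n-1), but both
    sides vanish through the factor 1 - p^(2n).\<close>
  have 1: "?B * basic_sum s t p (n - 1) z
      = (\<Sum>k\<le>Suc n. ?B * wgt t p (p ^ n / p) k * basis s p z k)"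
  proof (cases n)
    case (Suc m)
    then have "p ^ n / p = p ^ (n - 1)" using assms by simp
    moreover have "basic_sum s t p (n - 1) z
        = (\<Sum>k\<le>Suc n. wgt t p (p ^ (n - 1)) k * basis s p z k)"
      using assms(1) by (rule basic_sum_extend) simp
    ultimately show ?thesis
      by (simp only: sum_distrib_left mult.assoc)
  qed simp
  have 2: "?A * basic_sum s t p (Suc n) z
      = (\<Sum>k\<le>Suc n. ?A * wgt t p (p ^ n * p) k * basis s p z k)"
    by (simp only: basic_sum_def sum_distrib_left mult.assoc power_Suc2)
  have "shift_op t p (basic_sum s t p n) z
    = (\<Sum>k\<le>n. wgt t p (p ^ n) k * (lower s t p k * basis s p z (k - 1)
        + diag s t p k * basis s p z k + raise s t p k * basis s p z (Suc k)))"
    unfolding shift_op_basis [OF assms(1,4,7,8,5), symmetric] shift_op_sum [symmetric]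
    by (simp add: basic_sum_def [abs_def])
  also have "\<dots> = (\<Sum>k\<le>Suc n. (wgt t p (p ^ n) (Suc k) * lower s t p (Suc k)
      + wgt t p (p ^ n) k * diag s t p k
      + (case k of 0 \<Rightarrow> 0 | Suc j \<Rightarrow> wgt t p (p ^ n) j * raise s t p j)) * basis s p z k)"
    by (rule sum_tridiagonal) (use assms(1) in \<open>auto simp: lower_def wgt_eq_0\<close>)
  also have "\<dots> = ?A * basic_sum s t p (Suc n) z + ?B * basic_sum s t p (n - 1) z"
    unfolding wgt_recurrence [OF assms(1-5) N assms(6)] 1 2 distrib_right sum.distrib ..
  finally show ?thesis .
qed

section \<open>Identification with the q-ultraspherical polynomials\<close>

text \<open>For the parameters s, -s, r, -r with r^2 = p one has ab = -t, {ac, ad} = {sr, -sr} and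
  abcd = tp. In the prefactor (tp; q)_n cancels, and (t; p)_n (-t; p)_n combines to (t^2;
  q)_n.\<close>

lemma bracket_q_ultraspherical:
  assumes "0 < q" "q < 1" "norm t < 1" "s \<noteq> 0" "s\<^sup>2 = t" "z \<noteq> 0"
  defines "p \<equiv> complex_of_real (q powr (1/2))"
  shows "bracket (q_ultraspherical s t q (int n)) z
    = qpoch (t\<^sup>2) (p\<^sup>2) n / (qpoch (p\<^sup>2) (p\<^sup>2) n * s ^ n) * basic_sum s t p n z"
proof -
  define r where "r = complex_of_real (q powr (1/4))"
  have rp: "r * r = p"
    unfolding r_def p_def of_real_mult [symmetric] powr_add [symmetric] by simp
  have "p\<^sup>2 = of_real ((q powr (1/2)) powr 2)"
    unfolding p_def using assms(1) by (simp add: powr_numeral)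
  then have p2: "p\<^sup>2 = of_real q"
    using assms(1) by (simp add: powr_powr)
  have p: "p \<noteq> 0" "norm p < 1"
    using assms(1,2) powr_less_mono2 [of "1/2" q 1] by (auto simp: p_def)
  have norm_tp: "norm (t * p) < 1" "norm (p\<^sup>2) < 1"
    using mult_strict_mono' [of "norm t" 1 "norm p" 1] mult_strict_mono' [of "norm p" 1 "norm p" 1] p assms(3)
    by (auto simp: norm_mult power2_eq_square)
  have sr: "qpoch (s * r) p k * qpoch (- (s * r)) p k = qpoch (t * p) (p\<^sup>2) k" for k
  proof -
    have "(s * r)\<^sup>2 = t * p" by (simp add: power_mult_distrib assms(5) rp [symmetric] power2_eq_square [of r])
    then show ?thesis unfolding qpoch_mult_uminus by simp
  qed
  have tt: "qpoch t p n * qpoch (- t) p n = qpoch (t\<^sup>2) (p\<^sup>2) n"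
    by (rule qpoch_mult_uminus)
  have ss: "s * s = t" using assms(5) by (simp add: power2_eq_square)
  have top: "p powi (int n - 1) * s * (- s) * r * (- r) = t * p ^ n"
  proof -
    have "p powi (int n - 1) * s * (- s) * r * (- r) = t * (p powi (int n - 1) * p)"
      unfolding ss [symmetric] rp [symmetric] by simp
    also have "p powi (int n - 1) * p = p ^ n"
      using p by (simp add: power_int_diff)
    finally show ?thesis .
  qed
  have summand: "qpochs [p powi (- int n), p powi (int n - 1) * s * (- s) * r * (- r), s * z, s * inverse z] p k
      / qpochs [s * (- s), s * r, s * (- r), p] p k * p ^ k = wgt t p (p ^ n) k * basis s p z k" for k
    unfolding top wgt_def sr [symmetric]
    by (simp add: qpochs_def basis_def ss power_int_minus divide_inverse mult_ac)
  have "bracket (q_ultraspherical s t q (int n)) z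
      = qpoch t p n / (qpoch (t * p) (p\<^sup>2) n * qpoch (p\<^sup>2) (p\<^sup>2) n)
        * askey_wilson_rhs s (- s) r (- r) p n z"
    using bracket_askey_wilson [OF assms(6), of s "- s" r "- r" p n]
    by (simp add: q_ultraspherical_def bracket_def Let_def p_def [symmetric] r_def [symmetric] p2 mult.commute)
  also have "askey_wilson_rhs s (- s) r (- r) p n z
      = qpoch (- t) p n * qpoch (t * p) (p\<^sup>2) n / s ^ n * basic_sum s t p n z"
    unfolding askey_wilson_rhs_def summand basic_sum_def
    by (simp add: qpochs_def ss sr [symmetric])
  finally show ?thesis
    unfolding tt [symmetric] using qpoch_nonzero [OF norm_tp, of n] by simp
qed

section \<open>Normalization and conclusion\<close>

theorem mainTheorem9:
  fixes q :: real and t s z :: complex and n :: nat and C :: "int \<Rightarrow> complex \<Rightarrow> complex"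
  assumes "0 < q" "q < 1"
    and "0 < norm t" "norm t < 1"
    and "s\<^sup>2 = t"
    and "z \<noteq> 0" "z - inverse z \<noteq> 0"
  defines "C \<equiv> \<lambda>m. bracket (q_ultraspherical s t q m)"
  shows
    "(1 - t * z powi 2) * (z powi (-2) - of_real (q powr (1/2))) / (z - inverse z)
        * C (int n) (of_real (q powr (1/2)) * z)
     - (1 - t * z powi (-2)) * (z powi 2 - of_real (q powr (1/2))) / (z - inverse z)
        * C (int n) (of_real (q powr (-1/2)) * z)
     = - ((1 - t * of_real (q powr (real n + 1/2))) * (1 - of_real (q powr (real n + 1))))
          / (of_real (q powr (real n / 2)) * (1 - t * of_real (q powr real n)))
          * C (int n + 1) z
       + (1 - t * of_real (q powr (real n - 1/2))) * (1 - t\<^sup>2 * of_real (q powr (real n - 1)))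
          / (of_real (q powr (real n / 2 - 1/2)) * (1 - t * of_real (q powr real n)))
          * C (int n - 1) z"
proof -
  define p where "p = complex_of_real (q powr (1/2))"
  define P where "P = p ^ n"
  have p: "p \<noteq> 0" "norm p < 1"
    using assms(1,2) powr_less_mono2 [of "1/2" q 1] by (auto simp: p_def)
  have pn: "p ^ k = of_real (q powr (real k / 2))" for k
    unfolding p_def of_real_power [symmetric] using assms(1)
    by (simp add: powr_powr powr_realpow [symmetric])
  have P: "P \<noteq> 0" using p by (simp add: P_def)
  have P2: "P\<^sup>2 = p ^ (2 * n)" by (simp add: P_def mult.commute flip: power_mult)
  have Pq: "of_real (q powr real n) = P\<^sup>2"
    unfolding P2 pn by simp
  have e: "of_real (q powr (1/2)) = p" "of_real (q powr (-1/2)) = 1 / p"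
    using assms(1) by (simp_all add: p_def powr_minus_divide)
  have e1: "of_real (q powr (real n + 1/2)) = p * P\<^sup>2"
    "of_real (q powr (real n + 1)) = p\<^sup>2 * P\<^sup>2"
    "of_real (q powr (real n / 2)) = P"
    "of_real (q powr (real n - 1/2)) = P\<^sup>2 / p"
    "of_real (q powr (real n - 1)) = P\<^sup>2 / p\<^sup>2"
    "of_real (q powr (real n / 2 - 1/2)) = P / p"
    using assms(1) unfolding powr_add powr_diff of_real_mult of_real_divide Pq e
    by (simp_all add: pn [of 2] P_def pn [of n])
  have s: "s \<noteq> 0" using assms(3,5) by auto
  have nz: "1 - t * P\<^sup>2 \<noteq> 0" 
  proof -
    have "norm (t * P\<^sup>2) < 1"
      unfolding P2 norm_mult norm_power using assms(4) p
        mult_left_mono [of "norm p ^ (2 * n)" 1 "norm t"] power_le_one [of "norm p" "2 * n"] by simp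
    then show ?thesis by auto
  qed
  have p1: "1 - p\<^sup>2 * p ^ (2 * k) \<noteq> 0" for k
  proof -
    have "norm (p ^ (2 * k + 2)) < 1"
      unfolding norm_power using p power_strict_decreasing [of 0 "2 * k + 2" "norm p"] by simp
    then have "p ^ (2 * k + 2) \<noteq> 1" by (metis norm_one less_irrefl)
    then show ?thesis unfolding power_add by (simp add: mult.commute)
  qed
  define K where "K m = qpoch (t\<^sup>2) (p\<^sup>2) m / (qpoch (p\<^sup>2) (p\<^sup>2) m * s ^ m)" for m
  have C: "C (int m) y = K m * basic_sum s t p m y" if "y \<noteq> 0" for m y
    unfolding C_def K_def p_def using assms(1,2,4) s assms(5) that by (rule bracket_q_ultraspherical)
  \<comment> \<open>This ratio of normalizing constants trades 1 - t^2 P^2 in \<open>A\<close> for 1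
    - p^2 P^2, and 1 - P^2 in \<open>B\<close> for 1 - t^2 P^2 / p^2; it also absorbs s.\<close>
  have K_Suc: "(1 - p\<^sup>2 * p ^ (2 * m)) * s * K (Suc m) = (1 - t\<^sup>2 * p ^ (2 * m)) * K m" for m
    using p1 [of m] s by (simp add: K_def qpoch_Suc power_mult)
  define A where "A = (1 - t * p * P\<^sup>2) * (1 - t\<^sup>2 * P\<^sup>2) / (s * P * (1 - t * P\<^sup>2))"
  define B where "B = s * p * (1 - t * P\<^sup>2 / p) * (1 - P\<^sup>2) / (P * (1 - t * P\<^sup>2))"
  have up: "K n * (- A * basic_sum s t p (Suc n) z)
      = - ((1 - t * (p * P\<^sup>2)) * (1 - p\<^sup>2 * P\<^sup>2)) / (P * (1 - t * P\<^sup>2)) * C (int n + 1) z"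
  proof -
    have "C (int n + 1) z = K (Suc n) * basic_sum s t p (Suc n) z"
      using C [OF assms(6), of "Suc n"] by (simp add: add.commute)
    moreover have "K n * A = (1 - t * (p * P\<^sup>2)) / (s * P * (1 - t * P\<^sup>2)) * ((1 - t\<^sup>2 * P\<^sup>2) * K n)"
      by (simp add: A_def mult_ac)
    then have "K n * A = (1 - t * (p * P\<^sup>2)) * (1 - p\<^sup>2 * P\<^sup>2) / (P * (1 - t * P\<^sup>2)) * K (Suc n)"
      unfolding P2 K_Suc [symmetric] using s by (simp add: mult_ac)
    ultimately show ?thesis
      by (metis (no_types, opaque_lifting) mult.assoc mult_minus_left mult_minus_right minus_divide_left)
  qed
  have down: "K n * (B * basic_sum s t p (n - 1) z)
      = (1 - t * (P\<^sup>2 / p)) * (1 - t\<^sup>2 * (P\<^sup>2 / p\<^sup>2)) / (P / p * (1 - t * P\<^sup>2)) * C (int n - 1) z"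
  proof (cases n)
    \<comment> \<open>The left side is 0 because \<open>B\<close> contains 1 - P^2 = 0, the right
      side because the polynomial of index -1 is 0 by convention.\<close>
    case 0
    then show ?thesis by (simp add: B_def P_def C_def q_ultraspherical_def bracket_def)
  next
    case (Suc m)
    have Pm: "P\<^sup>2 = p\<^sup>2 * p ^ (2 * m)"
      unfolding P2 Suc by (simp add: power_add power2_eq_square)
    have "K n * B = p * (1 - t * (P\<^sup>2 / p)) / (P * (1 - t * P\<^sup>2)) * ((1 - P\<^sup>2) * s * K n)"
      by (simp add: B_def mult_ac)
    also have "(1 - P\<^sup>2) * s * K n = (1 - t\<^sup>2 * (P\<^sup>2 / p\<^sup>2)) * K m"
      unfolding Pm Suc K_Suc using p by simp
    finally have "K n * B = (1 - t * (P\<^sup>2 / p)) * (1 - t\<^sup>2 * (P\<^sup>2 / p\<^sup>2)) / (P / p * (1 - t * P\<^sup>2)) * K m"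
      by (simp add: mult_ac)
    moreover have "C (int n - 1) z = K m * basic_sum s t p m z"
      using C [OF assms(6), of m] by (simp add: Suc)
    ultimately show ?thesis
      by (simp add: Suc mult.assoc [symmetric])
  qed
  have "shift_op t p (basic_sum s t p n) z
      = - A * basic_sum s t p (Suc n) z + B * basic_sum s t p (n - 1) z"
    unfolding A_def B_def P_def
    using shift_op_basic_sum [OF p assms(4) s assms(5) nz [unfolded P_def] assms(6)] assms(7)
    by (simp add: inverse_eq_divide)
  then have "K n * shift_op t p (basic_sum s t p n) z
      = K n * (- A * basic_sum s t p (Suc n) z) + K n * (B * basic_sum s t p (n - 1) z)"
    by (simp only: distrib_left)
  moreover have "K n * shift_op t p (basic_sum s t p n) z
    = (1 - t * z powi 2) * (z powi (-2) - p) / (z - inverse z) * C (int n) (p * z)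
     - (1 - t * z powi (-2)) * (z powi 2 - p) / (z - inverse z) * C (int n) (1 / p * z)"
  proof -
    have "C (int n) (p * z) = K n * basic_sum s t p n (p * z)"
        "C (int n) (1 / p * z) = K n * basic_sum s t p n (z / p)"
      using C [of "p * z" n] C [of "z / p" n] p assms(6) by simp_all
    then show ?thesis
      by (simp add: shift_op_def power_int_minus inverse_eq_divide add_divide_distrib diff_divide_distrib algebra_simps)
  qed
  ultimately show ?thesis
    unfolding up down e e1 Pq by simp
qed

end
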